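(* Let $a = h\sum_{j=1}^{N_\Theta}\alpha_j\sum_{k=1}^N\theta_{jk}$ and let the time step satisfy $0<\delta t\le 1/a$ (with $1/a=+\infty$ if $a=0$). Then the Euler–Chang–Cooper scheme $$(I-\delta t\,A)f^{m}=f^{m-1}+\delta t\,Q(f^{m-1};\bar\alpha)$$ on the periodic grid is positivity preserving: if $f^{m-1}\in\mathbb{R}^N$ is componentwise non-negative, then $f^m$ is componentwise non-negative.
   Context: Setting. $\Omega=[\Omega_a,\Omega_b]$ is an interval with its end points identified (a torus). $b\in\mathbb{R}$, $\sigma^2>0$, $B=-b$, $C=\sigma^2/2>0$. The space grid is $x_i=\Omega_a+ih$, $i=0,\dots,N$, $h=(\Omega_b-\Omega_a)/N$, $N\ge 3$; since $x_0$ and $x_N$ are identified, grid functions are vectors $f=(f_1,\dots,f_N)^\top\in\mathbb{R}^N$ with indices read modulo $N$. Vector inequalities are componentwise. Matrix $A$ (Chang–Cooper discretization of $f\mapsto\partial_x(Bf+C\partial_x f)$): let $\omega=\exp(hB/C)$ and $\beta=B/(\omega-1)$ (with $\beta=C/h$ if $B=0$), so $\beta>0$. $A\in\mathbb{R}^{N\times N}$ has entries $A_{i,i}=-\beta(1+\omega)/h$, $A_{i,i-1}=\beta/h$, $A_{i,i+1}=\omega\beta/h$, $A_{1,N}=\beta/h$, $A_{N,1}=\omega\beta/h$, and all other entries $0$. Jump term: $\bar\alpha=(\alpha_1,\dots,\alpha_{N_\Theta})$ with $\alpha_j\ge0$. $\Delta=(\Omega_b-\Omega_a)/N_\Theta$,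 $\theta_j=\Omega_a+\Delta(j-1)$, and $\Theta_j$ is the hat function on the torus $\Theta_j(s)=1+(s-\theta_j)/\Delta$ on $[\theta_j-\Delta,\theta_j]$, $\Theta_j(s)=1-(s-\theta_j)/\Delta$ on $[\theta_j,\theta_j+\Delta]$, zero elsewhere (extended periodically, $\Theta_1\equiv\Theta_{N_\Theta+1}$). With $s_k=x_k$, put $\theta_{jk}=\Theta_j(s_k)\ge0$. For a grid function $f$, $\hat f_{ik}$ is $f$ translated by $s_k$ and continued by periodicity, i.e. $\hat f_{ik}=f_{i+\sigma_k}$ (index mod $N$), where the integer $\sigma_k$ is the number of grid cells of the translation by $s_k$ ($\sigma_k=s_k/h$ when $0$ is a grid point; the result does not depend on which integers $\sigma_k$ are used). Then $Q(f;\bar\alpha)\in\mathbb{R}^N$ is given by $$Q(f;\bar\alpha)_i=h\sum_{j=1}^{N_\Theta}\alpha_j\sum_{k=1}^N\hat f_{ik}\,\theta_{jk}-a f_i,\qquad a=h\sum_{j=1}^{N_\Theta}\alpha_j\sum_{k=1}^N\theta_{jk}.$$ The scheme discretizes $\partial_t f=\partial_x(Bf+C\partial_x f)+\int_\Omega\sum_j\alpha_j(f(x+s,t)-f(x,t))\Theta_j(s)\,ds$. *)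

theory Defs
  imports Complex_Main "Jordan_Normal_Form.Matrix"
begin

text \<open>
  The torus is \<open>[\<Omega>\<^sub>a, \<Omega>\<^sub>b]\<close> with end points identified, and grid point \<open>0\<close> is grid point \<open>N\<close>.
  A grid function \<open>(f\<^sub>1, \<dots>, f\<^sub>N)\<close> is a vector of dimension \<open>N\<close> whose entry \<open>f $ i\<close>,
  \<open>i < N\<close>, is the value \<open>f\<^bsub>i+1\<^esub>\<close>; matrix rows and columns are shifted in the same way.
\<close>

definition mesh :: "real \<Rightarrow> real \<Rightarrow> nat \<Rightarrow> real" where
  "mesh \<Omega>\<^sub>a \<Omega>\<^sub>b N = (\<Omega>\<^sub>b - \<Omega>\<^sub>a) / real N"

definition grid_pt :: "real \<Rightarrow> real \<Rightarrow> nat \<Rightarrow> nat \<Rightarrow> real" where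
  "grid_pt \<Omega>\<^sub>a \<Omega>\<^sub>b N k = \<Omega>\<^sub>a + real k * mesh \<Omega>\<^sub>a \<Omega>\<^sub>b N"

definition cc_omega :: "real \<Rightarrow> real \<Rightarrow> real \<Rightarrow> real" where
  "cc_omega h B C = exp (h * B / C)"

definition cc_beta :: "real \<Rightarrow> real \<Rightarrow> real \<Rightarrow> real" where
  "cc_beta h B C = (if B = 0 then C / h else B / (cc_omega h B C - 1))"

definition chang_cooper_mat :: "nat \<Rightarrow> real \<Rightarrow> real \<Rightarrow> real \<Rightarrow> real mat" where
  "chang_cooper_mat N h B C = mat N N (\<lambda>(i, j).
     if j = i then - cc_beta h B C * (1 + cc_omega h B C) / h
     else if i = j + 1 \<or> (i = 0 \<and> j = N - 1) then cc_beta h B C / h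
     else if j = i + 1 \<or> (i = N - 1 \<and> j = 0) then cc_omega h B C * cc_beta h B C / h
     else 0)"

definition hat_fun :: "real \<Rightarrow> real \<Rightarrow> real \<Rightarrow> real" where
  "hat_fun \<theta> \<Delta> s =
     (if \<theta> - \<Delta> \<le> s \<and> s \<le> \<theta> then 1 + (s - \<theta>) / \<Delta>
      else if \<theta> \<le> s \<and> s \<le> \<theta> + \<Delta> then 1 - (s - \<theta>) / \<Delta>
      else 0)"

text \<open>
  Periodic extension with period \<open>L\<close>: the sum of all translates by multiples of \<open>L\<close>. The sum
  is restricted to the translates whose support contains \<open>s\<close>, so that its index set is finite.
  If \<open>2 * \<Delta> \<le> L\<close>, supports overlap at most in end points, where the hat vanishes
  (lemma \<open>periodic_hat_eq\<close> below).
\<close>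

definition periodic_hat :: "real \<Rightarrow> real \<Rightarrow> real \<Rightarrow> real \<Rightarrow> real" where
  "periodic_hat L \<theta> \<Delta> s =
     (\<Sum>n | \<theta> - \<Delta> \<le> s + of_int n * L \<and> s + of_int n * L \<le> \<theta> + \<Delta>.
        hat_fun \<theta> \<Delta> (s + of_int n * L))"

definition jump_width :: "real \<Rightarrow> real \<Rightarrow> nat \<Rightarrow> real" where
  "jump_width \<Omega>\<^sub>a \<Omega>\<^sub>b N\<^sub>\<Theta> = (\<Omega>\<^sub>b - \<Omega>\<^sub>a) / real N\<^sub>\<Theta>"

definition jump_node :: "real \<Rightarrow> real \<Rightarrow> nat \<Rightarrow> nat \<Rightarrow> real" where
  "jump_node \<Omega>\<^sub>a \<Omega>\<^sub>b N\<^sub>\<Theta> j = \<Omega>\<^sub>a + jump_width \<Omega>\<^sub>a \<Omega>\<^sub>b N\<^sub>\<Theta> * (real j - 1)"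

definition jump_hat :: "real \<Rightarrow> real \<Rightarrow> nat \<Rightarrow> nat \<Rightarrow> real \<Rightarrow> real" where
  "jump_hat \<Omega>\<^sub>a \<Omega>\<^sub>b N\<^sub>\<Theta> j =
     periodic_hat (\<Omega>\<^sub>b - \<Omega>\<^sub>a) (jump_node \<Omega>\<^sub>a \<Omega>\<^sub>b N\<^sub>\<Theta> j) (jump_width \<Omega>\<^sub>a \<Omega>\<^sub>b N\<^sub>\<Theta>)"

definition jump_weight :: "real \<Rightarrow> real \<Rightarrow> nat \<Rightarrow> nat \<Rightarrow> nat \<Rightarrow> nat \<Rightarrow> real" where
  "jump_weight \<Omega>\<^sub>a \<Omega>\<^sub>b N N\<^sub>\<Theta> j k = jump_hat \<Omega>\<^sub>a \<Omega>\<^sub>b N\<^sub>\<Theta> j (grid_pt \<Omega>\<^sub>a \<Omega>\<^sub>b N k)"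

definition jump_rate :: "real \<Rightarrow> real \<Rightarrow> nat \<Rightarrow> nat \<Rightarrow> (nat \<Rightarrow> real) \<Rightarrow> real" where
  "jump_rate \<Omega>\<^sub>a \<Omega>\<^sub>b N N\<^sub>\<Theta> \<alpha> =
     mesh \<Omega>\<^sub>a \<Omega>\<^sub>b N * (\<Sum>j=1..N\<^sub>\<Theta>. \<alpha> j * (\<Sum>k=1..N. jump_weight \<Omega>\<^sub>a \<Omega>\<^sub>b N N\<^sub>\<Theta> j k))"

text \<open>The entry with index \<open>i\<close> of \<open>f\<close> translated by \<open>m\<close> grid cells; indices are read modulo the dimension.\<close>

definition translate_entry :: "int \<Rightarrow> real vec \<Rightarrow> nat \<Rightarrow> real" where
  "translate_entry m f i = f $ nat ((int i + m) mod int (dim_vec f))"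

text \<open>\<open>shift k\<close> is the number of grid cells of the translation by the grid point \<open>s\<^sub>k\<close>.\<close>

definition jump_op ::
  "real \<Rightarrow> real \<Rightarrow> nat \<Rightarrow> nat \<Rightarrow> (nat \<Rightarrow> int) \<Rightarrow> (nat \<Rightarrow> real) \<Rightarrow> real vec \<Rightarrow> real vec" where
  "jump_op \<Omega>\<^sub>a \<Omega>\<^sub>b N N\<^sub>\<Theta> shift \<alpha> f = vec N (\<lambda>i.
     mesh \<Omega>\<^sub>a \<Omega>\<^sub>b N * (\<Sum>j=1..N\<^sub>\<Theta>. \<alpha> j *
        (\<Sum>k=1..N. translate_entry (shift k) f i * jump_weight \<Omega>\<^sub>a \<Omega>\<^sub>b N N\<^sub>\<Theta> j k))
     - jump_rate \<Omega>\<^sub>a \<Omega>\<^sub>b N N\<^sub>\<Theta> \<alpha> * f $ i)"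

lemma periodic_hat_eq:
  assumes "0 < \<Delta>" and "2 * \<Delta> \<le> L" and s: "\<theta> - \<Delta> \<le> s" "s \<le> \<theta> + \<Delta>"
  shows "periodic_hat L \<theta> \<Delta> s = hat_fun \<theta> \<Delta> s"
proof -
  let ?S = "{n::int. \<theta> - \<Delta> \<le> s + of_int n * L \<and> s + of_int n * L \<le> \<theta> + \<Delta>}"
  have L: "0 < L" using assms by linarith
  have bnd: "-1 \<le> n \<and> n \<le> 1" if "n \<in> ?S" for n
  proof -
    have "\<bar>of_int n * L\<bar> \<le> 1 * L" using that assms by auto
    then have "\<bar>of_int n\<bar> * L \<le> 1 * L" using L by (simp add: abs_mult)
    then have "\<bar>real_of_int n\<bar> \<le> 1" using L by (simp add: mult_le_cancel_right)
    then show ?thesis by linarith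
  qed
  have fin: "finite ?S" by (rule finite_subset[of _ "{-1..1}"]) (use bnd in auto)
  have zero: "hat_fun \<theta> \<Delta> (s + of_int n * L) = 0" if "n \<in> ?S - {0}" for n
  proof -
    have "n = 1 \<or> n = -1" using bnd[of n] that by auto
    then have "s + of_int n * L = \<theta> + \<Delta> \<or> s + of_int n * L = \<theta> - \<Delta>"
      using that assms by auto
    then show ?thesis using assms by (auto simp: hat_fun_def)
  qed
  have "periodic_hat L \<theta> \<Delta> s = (\<Sum>n\<in>{0}. hat_fun \<theta> \<Delta> (s + of_int n * L))"
    unfolding periodic_hat_def
    by (rule sum.mono_neutral_right) (use fin zero s in auto)
  then show ?thesis by simp
qed

lemma periodic_hat_periodic: "periodic_hat L \<theta> \<Delta> (s + of_int m * L) = periodic_hat L \<theta> \<Delta> s"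
  unfolding periodic_hat_def
  by (rule sum.reindex_bij_witness[of _ "\<lambda>n. n - m" "\<lambda>n. n + m"]) (auto simp: algebra_simps)

end

theory Submission
  imports Defs
begin

text \<open>
  The implicit matrix \<open>I - \<tau> A\<close> is inverse-positive because \<open>A\<close> generates a Markov jump process
  on the periodic grid: its off-diagonal entries are non-negative and its rows sum to zero
  (\<open>chang_cooper_mat_offdiag_nonneg\<close>, \<open>chang_cooper_mat_row_sum\<close>). Instead of invoking the theory
  of M-matrices, \<open>implicit_euler_nonneg\<close> argues by a discrete minimum principle: at an index
  where the solution attains its minimum, all differences to other entries are non-negative, so
  the generator can only raise the value there, and the minimum is at least the corresponding
  entry of the right-hand side.

  It remains to see that the explicit right-hand side is non-negative. There the gain part of
  the jump operator is a non-negative combination of old values, and the loss part turns the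
  coefficient of the old value into \<open>1 - \<tau> a\<close>, which is where the time step restriction is
  used (\<open>explicit_jump_step_nonneg\<close>).
\<close>

text \<open>
  At a minimising index \<open>i\<close> the \<open>i\<close>-th entry of the left-hand side is
  \<open>f\<^sub>i (1 - \<tau> \<Sum>\<^sub>j A\<^sub>i\<^sub>j) - \<tau> \<Sum>\<^sub>j A\<^sub>i\<^sub>j (f\<^sub>j - f\<^sub>i)\<close>. The last sum is non-negative, since its diagonal
  term vanishes, and the factor of \<open>f\<^sub>i\<close> is at least one. A negative minimum would therefore
  force a negative right-hand side.
\<close>

lemma implicit_euler_nonneg:
  fixes A :: "real mat" and f g :: "real vec"
  assumes A: "A \<in> carrier_mat n n" and f: "f \<in> carrier_vec n"
    and \<tau>: "0 \<le> \<tau>"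
    and offdiag: "\<And>i j. i < n \<Longrightarrow> j < n \<Longrightarrow> i \<noteq> j \<Longrightarrow> 0 \<le> A $$ (i, j)"
    and rows: "\<And>i. i < n \<Longrightarrow> (\<Sum>j<n. A $$ (i, j)) \<le> 0"
    and eq: "(1\<^sub>m n - \<tau> \<cdot>\<^sub>m A) *\<^sub>v f = g"
    and g: "\<And>i. i < n \<Longrightarrow> 0 \<le> g $ i"
    and k: "k < n"
  shows "0 \<le> f $ k"
proof -
  define m where "m = Min ((\<lambda>i. f $ i) ` {..<n})"
  have "m \<in> (\<lambda>i. f $ i) ` {..<n}" unfolding m_def by (rule Min_in) (use k in auto)
  then obtain i where i: "i < n" and m: "m = f $ i" by auto
  have min: "f $ i \<le> f $ j" if "j < n" for j
    using that unfolding m[symmetric] m_def by (intro Min_le) auto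
  have "g $ i = (\<Sum>j<n. ((if i = j then 1 else 0) - \<tau> * A $$ (i, j)) * f $ j)"
    using A f i by (simp add: eq[symmetric] scalar_prod_def lessThan_atLeast0)
  also have "\<dots> = (\<Sum>j<n. (if i = j then f $ j else 0) - \<tau> * (A $$ (i, j) * f $ j))"
    by (rule sum.cong) (auto simp: algebra_simps)
  also have "\<dots> = f $ i - \<tau> * (\<Sum>j<n. A $$ (i, j) * f $ j)"
    using i by (simp add: sum_subtractf sum_distrib_left)
  finally have gi: "g $ i = f $ i - \<tau> * (\<Sum>j<n. A $$ (i, j) * f $ j)" .
  have diff: "0 \<le> (\<Sum>j<n. A $$ (i, j) * (f $ j - f $ i))"
  proof (rule sum_nonneg)
    fix j assume "j \<in> {..<n}"
    then show "0 \<le> A $$ (i, j) * (f $ j - f $ i)"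
      using offdiag[of i j] min[of j] i by (cases "i = j") auto
  qed
  have decomp: "(\<Sum>j<n. A $$ (i, j) * f $ j)
      = (\<Sum>j<n. A $$ (i, j) * (f $ j - f $ i)) + f $ i * (\<Sum>j<n. A $$ (i, j))"
    by (simp add: algebra_simps sum_subtractf sum_distrib_left)
  have "0 \<le> f $ i"
  proof (rule ccontr)
    assume neg: "\<not> 0 \<le> f $ i"
    have "0 \<le> f $ i * (\<Sum>j<n. A $$ (i, j))"
      using neg rows[OF i] by (intro mult_nonpos_nonpos) auto
    then have "0 \<le> \<tau> * (\<Sum>j<n. A $$ (i, j) * f $ j)"
      using diff decomp \<tau> by simp
    then show False using gi g[OF i] neg by linarith
  qed
  then show ?thesis using min[OF k] by linarith
qed

text \<open>The numerator and denominator of \<open>B / (exp (h B / C) - 1)\<close> have the same sign.\<close>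

lemma cc_beta_pos:
  assumes "0 < h" "0 < C"
  shows "0 < cc_beta h B C"
proof (cases B "0::real" rule: linorder_cases)
  case less
  then have "h * B / C < 0" using assms by (simp add: divide_neg_pos mult_pos_neg)
  then show ?thesis using less by (simp add: cc_beta_def cc_omega_def divide_neg_neg)
qed (use assms in \<open>auto simp: cc_beta_def cc_omega_def\<close>)

lemma chang_cooper_mat_carrier: "chang_cooper_mat N h B C \<in> carrier_mat N N"
  by (simp add: chang_cooper_mat_def)

lemma chang_cooper_mat_offdiag_nonneg:
  assumes "0 < h" "0 < C" "i < N" "j < N" "i \<noteq> j"
  shows "0 \<le> chang_cooper_mat N h B C $$ (i, j)"
  using assms cc_beta_pos[OF assms(1,2), of B]
  by (auto simp: chang_cooper_mat_def cc_omega_def)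

text \<open>
  The rows sum to zero because constant functions are steady states: with constant \<open>B\<close> and \<open>C\<close>
  the numerical flux of a constant is the same through every cell boundary.
  With at least three grid points a point and its two periodic neighbours are distinct, so that
  each of the three stencil coefficients occurs exactly once in the row.
\<close>

lemma chang_cooper_mat_row_sum:
  assumes N: "3 \<le> N" and i: "i < N"
  shows "(\<Sum>j<N. chang_cooper_mat N h B C $$ (i, j)) = 0"
proof -
  define \<omega> \<beta> where "\<omega> = cc_omega h B C" and "\<beta> = cc_beta h B C"
  define p s where "p = (if i = 0 then N - 1 else i - 1)"
    and "s = (if i = N - 1 then 0 else i + 1)"
  have ps: "p < N" "s < N" using N i by (auto simp: p_def s_def)
  have entry: "chang_cooper_mat N h B C $$ (i, j)
      = (if j = i then - \<beta> * (1 + \<omega>) / h else 0) + (if j = p then \<beta> / h else 0)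
        + (if j = s then \<omega> * \<beta> / h else 0)" if "j < N" for j
  proof -
    have "p \<noteq> i" "s \<noteq> i" "p \<noteq> s" using N i by (auto simp: p_def s_def split: if_splits)
    moreover have "i = j + 1 \<or> (i = 0 \<and> j = N - 1) \<longleftrightarrow> j = p"
      using that i by (auto simp: p_def)
    moreover have "j = i + 1 \<or> (i = N - 1 \<and> j = 0) \<longleftrightarrow> j = s"
      using that i by (auto simp: s_def)
    ultimately show ?thesis
      using that i by (auto simp: chang_cooper_mat_def \<omega>_def \<beta>_def)
  qed
  have "(\<Sum>j<N. chang_cooper_mat N h B C $$ (i, j))
      = - \<beta> * (1 + \<omega>) / h + \<beta> / h + \<omega> * \<beta> / h"
    using i ps by (simp add: entry sum.distrib)
  also have "\<dots> = 0"
    by (cases "h = 0") (simp_all add: field_simps)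
  finally show ?thesis .
qed

lemma hat_fun_nonneg:
  assumes "0 < \<Delta>"
  shows "0 \<le> hat_fun \<theta> \<Delta> s"
  using assms by (auto simp: hat_fun_def field_simps)

lemma jump_weight_nonneg:
  assumes "\<Omega>\<^sub>a < \<Omega>\<^sub>b" "1 \<le> N\<^sub>\<Theta>"
  shows "0 \<le> jump_weight \<Omega>\<^sub>a \<Omega>\<^sub>b N N\<^sub>\<Theta> j k"
  unfolding jump_weight_def jump_hat_def periodic_hat_def
  using assms by (intro sum_nonneg hat_fun_nonneg) (simp add: jump_width_def)

lemma mesh_nonneg: "\<Omega>\<^sub>a \<le> \<Omega>\<^sub>b \<Longrightarrow> 0 \<le> mesh \<Omega>\<^sub>a \<Omega>\<^sub>b N"
  by (simp add: mesh_def)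

lemma jump_rate_nonneg:
  assumes "\<Omega>\<^sub>a < \<Omega>\<^sub>b" "1 \<le> N\<^sub>\<Theta>" "\<And>j. j \<in> {1..N\<^sub>\<Theta>} \<Longrightarrow> 0 \<le> \<alpha> j"
  shows "0 \<le> jump_rate \<Omega>\<^sub>a \<Omega>\<^sub>b N N\<^sub>\<Theta> \<alpha>"
  unfolding jump_rate_def
  using assms by (intro mult_nonneg_nonneg sum_nonneg mesh_nonneg jump_weight_nonneg) auto

lemma translate_entry_nonneg:
  assumes "\<And>i. i < dim_vec f \<Longrightarrow> 0 \<le> f $ i" "0 < dim_vec f"
  shows "0 \<le> translate_entry m f i"
proof -
  have "nat ((int i + m) mod int (dim_vec f)) < dim_vec f"
    using assms(2) by (simp add: nat_less_iff)
  then show ?thesis unfolding translate_entry_def by (rule assms(1))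
qed

text \<open>
  The step equals \<open>(1 - \<tau> a) f\<^sub>i + \<tau> h \<Sum>\<^sub>j \<alpha>\<^sub>j \<Sum>\<^sub>k f\<^bsub>i+\<sigma>\<^sub>k\<^esub> \<theta>\<^sub>j\<^sub>k\<close>, a combination of values of \<open>f\<close>
  with non-negative coefficients as soon as \<open>\<tau> a \<le> 1\<close>.
\<close>

lemma explicit_jump_step_nonneg:
  assumes dom: "\<Omega>\<^sub>a < \<Omega>\<^sub>b" "1 \<le> N\<^sub>\<Theta>"
    and \<alpha>: "\<And>j. j \<in> {1..N\<^sub>\<Theta>} \<Longrightarrow> 0 \<le> \<alpha> j"
    and \<tau>: "0 \<le> \<tau>" "\<tau> * jump_rate \<Omega>\<^sub>a \<Omega>\<^sub>b N N\<^sub>\<Theta> \<alpha> \<le> 1"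
    and f: "f \<in> carrier_vec N" "\<And>i. i < N \<Longrightarrow> 0 \<le> f $ i"
    and i: "i < N"
  shows "0 \<le> (f + \<tau> \<cdot>\<^sub>v jump_op \<Omega>\<^sub>a \<Omega>\<^sub>b N N\<^sub>\<Theta> shift \<alpha> f) $ i"
proof -
  define gain where "gain = mesh \<Omega>\<^sub>a \<Omega>\<^sub>b N * (\<Sum>j=1..N\<^sub>\<Theta>. \<alpha> j *
        (\<Sum>k=1..N. translate_entry (shift k) f i * jump_weight \<Omega>\<^sub>a \<Omega>\<^sub>b N N\<^sub>\<Theta> j k))"
  have "0 \<le> translate_entry m f i" for m
    using f i by (intro translate_entry_nonneg) auto
  then have gain: "0 \<le> gain"
    unfolding gain_def using dom \<alpha>
    by (intro mult_nonneg_nonneg sum_nonneg mesh_nonneg jump_weight_nonneg) auto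
  have "(f + \<tau> \<cdot>\<^sub>v jump_op \<Omega>\<^sub>a \<Omega>\<^sub>b N N\<^sub>\<Theta> shift \<alpha> f) $ i
      = (1 - \<tau> * jump_rate \<Omega>\<^sub>a \<Omega>\<^sub>b N N\<^sub>\<Theta> \<alpha>) * f $ i + \<tau> * gain"
    using i by (simp add: jump_op_def gain_def algebra_simps)
  then show ?thesis using gain \<tau> f(2)[OF i] by simp
qed

theorem theorem1:
  fixes \<Omega>\<^sub>a \<Omega>\<^sub>b b \<sigma> \<delta>t :: real
    and N N\<^sub>\<Theta> :: nat
    and shift :: "nat \<Rightarrow> int"
    and \<alpha> :: "nat \<Rightarrow> real"
    and f_old f_new :: "real vec"
  assumes "\<Omega>\<^sub>a < \<Omega>\<^sub>b"
    and "N \<ge> 3"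
    and "N\<^sub>\<Theta> \<ge> 1"
    and "\<sigma>\<^sup>2 > 0"
    and "\<forall>j\<in>{1..N\<^sub>\<Theta>}. \<alpha> j \<ge> 0"
    and "0 < \<delta>t"
    and "jump_rate \<Omega>\<^sub>a \<Omega>\<^sub>b N N\<^sub>\<Theta> \<alpha> \<noteq> 0 \<longrightarrow> \<delta>t \<le> 1 / jump_rate \<Omega>\<^sub>a \<Omega>\<^sub>b N N\<^sub>\<Theta> \<alpha>"
    and "f_old \<in> carrier_vec N"
    and "f_new \<in> carrier_vec N"
    and "(1\<^sub>m N - \<delta>t \<cdot>\<^sub>m chang_cooper_mat N (mesh \<Omega>\<^sub>a \<Omega>\<^sub>b N) (- b) (\<sigma>\<^sup>2 / 2)) *\<^sub>v f_new
           = f_old + \<delta>t \<cdot>\<^sub>v jump_op \<Omega>\<^sub>a \<Omega>\<^sub>b N N\<^sub>\<Theta> shift \<alpha> f_old"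
    and "\<forall>i<N. 0 \<le> f_old $ i"
  shows "\<forall>i<N. 0 \<le> f_new $ i"
proof (intro allI impI)
  fix k assume k: "k < N"
  let ?a = "jump_rate \<Omega>\<^sub>a \<Omega>\<^sub>b N N\<^sub>\<Theta> \<alpha>" and ?h = "mesh \<Omega>\<^sub>a \<Omega>\<^sub>b N"
  have h: "0 < ?h" using assms(1,2) by (simp add: mesh_def)
  have C: "0 < \<sigma>\<^sup>2 / 2" using assms(4) by simp
  have "0 \<le> ?a" using assms(1,3,5) by (intro jump_rate_nonneg) auto
  then have "\<delta>t * ?a \<le> 1"
    using assms(7) by (cases "?a = 0") (auto simp: field_simps)
  then have rhs: "0 \<le> (f_old + \<delta>t \<cdot>\<^sub>v jump_op \<Omega>\<^sub>a \<Omega>\<^sub>b N N\<^sub>\<Theta> shift \<alpha> f_old) $ i" if "i < N" for i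
    using assms that by (intro explicit_jump_step_nonneg) auto
  show "0 \<le> f_new $ k"
  proof (rule implicit_euler_nonneg[OF chang_cooper_mat_carrier assms(9) _ _ _ assms(10) rhs k])
    show "0 \<le> \<delta>t" using assms(6) by simp
  qed (use assms(2) h C in
      \<open>simp_all add: chang_cooper_mat_offdiag_nonneg chang_cooper_mat_row_sum\<close>)
qed

end
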